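(* Let $0<\alpha<1$ and $p,q>0$. If $SG_{\alpha,p}(A,B)\le_{\mathrm{near}}\mathcal{A}_{\alpha,q}(A,B)$ for all positive definite $2\times2$ matrices $A,B$, then $q/p\ge1+\max\{\alpha(q-1),(1-\alpha)(q-1)\}$; hence $\frac{q}{p}\ge1+\max\{\alpha,1-\alpha\}(q-1)\ge1$ if $q\ge1$, and $\frac{q}{p}\ge1-\min\{\alpha,1-\alpha\}(1-q)\ge\max\{\alpha,1-\alpha\}$ if $0<q\le1$.
   Context: For positive definite $A,B$: $A\#B:=A^{1/2}(A^{-1/2}BA^{-1/2})^{1/2}A^{1/2}$; $F_\alpha(A,B):=(A^{-1}\#B)^\alpha A(A^{-1}\#B)^\alpha$; $SG_{\alpha,p}(A,B):=F_\alpha(A^p,B^p)^{1/p}$; $\mathcal{A}_{\alpha,q}(A,B):=((1-\alpha)A^q+\alpha B^q)^{1/q}$. For positive definite $X,Y$, $X\le_{\mathrm{near}}Y$ (near order) means $X\#Y^{-1}\le I$ in the Loewner order. *)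

theory Defs
  imports "HOL-Analysis.Analysis"
begin

type_synonym cmat2 = "complex^2^2"

definition adj :: "cmat2 \<Rightarrow> cmat2" where
  "adj A = (\<chi> i j. cnj (A $ j $ i))"

definition hermitian :: "cmat2 \<Rightarrow> bool" where
  "hermitian A \<longleftrightarrow> adj A = A"

definition qform :: "cmat2 \<Rightarrow> complex^2 \<Rightarrow> complex" where
  "qform A x = (\<Sum>i\<in>UNIV. cnj (x $ i) * (A *v x) $ i)"

definition posdef :: "cmat2 \<Rightarrow> bool" where
  "posdef A \<longleftrightarrow> hermitian A \<and> (\<forall>x. x \<noteq> 0 \<longrightarrow> 0 < Re (qform A x))"

definition possemidef :: "cmat2 \<Rightarrow> bool" where
  "possemidef A \<longleftrightarrow> hermitian A \<and> (\<forall>x. 0 \<le> Re (qform A x))"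

definition loewner_le :: "cmat2 \<Rightarrow> cmat2 \<Rightarrow> bool" where
  "loewner_le X Y \<longleftrightarrow> possemidef (Y - X)"

definition unitary :: "cmat2 \<Rightarrow> bool" where
  "unitary U \<longleftrightarrow> adj U ** U = mat 1"

definition diagm :: "real^2 \<Rightarrow> cmat2" where
  "diagm d = (\<chi> i j. if i = j then complex_of_real (d $ i) else 0)"

definition mpow :: "cmat2 \<Rightarrow> real \<Rightarrow> cmat2" where
  "mpow A t = (SOME B. \<exists>U l. unitary U \<and> (\<forall>i. 0 < l $ i) \<and>
      A = U ** diagm l ** adj U \<and> B = U ** diagm (\<chi> i. (l $ i) powr t) ** adj U)"

definition gmean :: "cmat2 \<Rightarrow> cmat2 \<Rightarrow> cmat2" where
  "gmean A B = mpow A (1/2) **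
     mpow (mpow A (-1/2) ** B ** mpow A (-1/2)) (1/2) ** mpow A (1/2)"

definition Fa :: "real \<Rightarrow> cmat2 \<Rightarrow> cmat2 \<Rightarrow> cmat2" where
  "Fa \<alpha> A B = mpow (gmean (matrix_inv A) B) \<alpha> ** A ** mpow (gmean (matrix_inv A) B) \<alpha>"

definition SG :: "real \<Rightarrow> real \<Rightarrow> cmat2 \<Rightarrow> cmat2 \<Rightarrow> cmat2" where
  "SG \<alpha> p A B = mpow (Fa \<alpha> (mpow A p) (mpow B p)) (1/p)"

definition Amean :: "real \<Rightarrow> real \<Rightarrow> cmat2 \<Rightarrow> cmat2 \<Rightarrow> cmat2" where
  "Amean \<alpha> q A B = mpow ((1 - \<alpha>) *\<^sub>R mpow A q + \<alpha> *\<^sub>R mpow B q) (1/q)"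

definition near_le :: "cmat2 \<Rightarrow> cmat2 \<Rightarrow> bool" where
  "near_le X Y \<longleftrightarrow> loewner_le (gmean X (matrix_inv Y)) (mat 1)"

end

theory Submission
  imports Defs
begin

text \<open>
  Writing \<open>B = G A G\<close> with \<open>G = A\<^sup>-\<^sup>1 # B\<close> gives \<open>F\<^sub>\<alpha>(A, B) = G\<^sup>\<alpha> A G\<^sup>\<alpha>\<close>, so \<open>A\<close> and \<open>G\<close> may be
  chosen freely. If \<open>X \<le> Y\<close> in the near order and \<open>K = X # Y\<^sup>-\<^sup>1 \<le> I\<close>, then
  \<open>Y = K\<^sup>-\<^sup>1 X K\<^sup>-\<^sup>1\<close>, which yields \<open>tr X\<^sup>2 \<le> tr X Y\<close>; this survives limits to singular \<open>X\<close>.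
  Let \<open>A\<close> tend to the projection onto the unit vector \<open>u = (c, s)\<close> and \<open>G\<close> to \<open>diag(1/c, 0)\<close>. Then
  \<open>B\<close> tends to the projection onto the first basis vector \<open>e\<close>, and the trace inequality becomes
  \<open>c\<close> to the power \<open>2(1-\<alpha>)/p\<close> is at most the \<open>(e, e)\<close> entry of
  \<open>((1-\<alpha>) uu\<^sup>* + \<alpha> ee\<^sup>*)\<close> to the power \<open>1/q\<close>. Both sides are 1 at \<open>s = 0\<close>; comparing their
  first-order terms in \<open>s\<^sup>2\<close> gives \<open>1/p \<ge> \<alpha>/q + (1-\<alpha>)\<close>, and exchanging \<open>A\<close> and \<open>B\<close> gives the
  same bound with \<open>1-\<alpha>\<close> in place of \<open>\<alpha>\<close>.
\<close>

section \<open>Real powers and geometric means of positive definite matrices\<close>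

lemmas mat2_simps = vec_eq_iff forall_2 matrix_matrix_mult_def matrix_vector_mult_def sum_2
  mat_def adj_def diagm_def

lemma adj_mult: "adj (A ** B) = adj B ** adj A"
  by (simp add: mat2_simps algebra_simps)

lemma adj_adj [simp]: "adj (adj A) = A"
  by (simp add: mat2_simps)

lemma adj_diagm [simp]: "adj (diagm l) = diagm l"
  by (simp add: mat2_simps)

lemma adj_mat_1 [simp]: "adj (mat 1) = mat 1"
  by (simp add: mat2_simps)

lemma diagm_mult: "diagm a ** diagm b = diagm (\<chi> i. a $ i * b $ i)"
  by (simp add: mat2_simps)

lemma diagm_1 [simp]: "diagm (\<chi> i. 1) = mat 1"
  by (simp add: mat2_simps)

lemma unitary_right: "unitary U \<Longrightarrow> U ** adj U = mat 1"
  unfolding unitary_def by (simp add: matrix_left_right_inverse)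

lemma unitary_adj: "unitary U \<Longrightarrow> unitary (adj U)"
  by (simp add: unitary_right unitary_def[of "adj U"])

lemma unitary_mult: "unitary U \<Longrightarrow> unitary V \<Longrightarrow> unitary (U ** V)"
  unfolding unitary_def adj_mult by (metis matrix_mul_assoc matrix_mul_lid)

lemma unitary_conj_mult:
  assumes "unitary U"
  shows "(U ** X ** adj U) ** (U ** Y ** adj U) = U ** (X ** Y) ** adj U"
  using assms unfolding unitary_def by (metis matrix_mul_assoc matrix_mul_rid)

text \<open>\<open>mpow\<close> selects an arbitrary diagonalization, so its value must be shown
  independent of that choice. Given two of them, \<open>W = adj V ** U\<close> intertwines the
  diagonal matrices, so \<open>W $ i $ j\<close> is nonzero only where \<open>l $ j = k $ i\<close>;
  hence \<open>W\<close> intertwines their powers as well.\<close>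

lemma mpow_spectral:
  assumes U: "unitary U" and l: "\<And>i. 0 < l $ i"
  shows "mpow (U ** diagm l ** adj U) t = U ** diagm (\<chi> i. l $ i powr t) ** adj U"
proof -
  let ?A = "U ** diagm l ** adj U"
  let ?P = "\<lambda>B. \<exists>V k. unitary V \<and> (\<forall>i. 0 < k $ i) \<and>
      ?A = V ** diagm k ** adj V \<and> B = V ** diagm (\<chi> i. (k $ i) powr t) ** adj V"
  have "?P (mpow ?A t)"
    unfolding mpow_def by (rule someI_ex) (use assms in blast)
  then obtain V k where V: "unitary V" and k: "\<And>i. 0 < k $ i"
    and eq: "?A = V ** diagm k ** adj V"
    and B: "mpow ?A t = V ** diagm (\<chi> i. (k $ i) powr t) ** adj V"
    by blast
  define W where "W = adj V ** U"
  have "adj V ** ?A ** U = W ** diagm l"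
    using U unfolding W_def unitary_def by (metis matrix_mul_assoc matrix_mul_rid)
  moreover have "adj V ** ?A ** U = diagm k ** W"
    using V unfolding W_def eq unitary_def by (metis matrix_mul_assoc matrix_mul_lid)
  ultimately have "W ** diagm l = diagm k ** W" by simp
  then have e: "W $ i $ j * of_real (l $ j) = of_real (k $ i) * W $ i $ j" for i j
    using exhaust_2[of i] exhaust_2[of j] by (auto simp: mat2_simps)
  have "W $ i $ j * of_real (l $ j powr t) = of_real (k $ i powr t) * W $ i $ j" for i j
  proof (cases "W $ i $ j = 0")
    case False
    then have "l $ j = k $ i" using e[of i j] by simp
    then show ?thesis by simp
  qed simp
  then have "W ** diagm (\<chi> i. l $ i powr t) = diagm (\<chi> i. k $ i powr t) ** W"
    by (simp add: mat2_simps)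
  then have "V ** (W ** diagm (\<chi> i. l $ i powr t)) ** adj U = V ** (diagm (\<chi> i. k $ i powr t) ** W) ** adj U"
    by simp
  moreover have "V ** (W ** diagm (\<chi> i. l $ i powr t)) = U ** diagm (\<chi> i. l $ i powr t)"
    using unitary_right[OF V] unfolding W_def by (metis matrix_mul_assoc matrix_mul_lid)
  moreover have "V ** (diagm (\<chi> i. k $ i powr t) ** W) ** adj U = V ** diagm (\<chi> i. k $ i powr t) ** adj V"
    using unitary_right[OF U] unfolding W_def by (metis matrix_mul_assoc matrix_mul_rid)
  ultimately show ?thesis using B by simp
qed

section \<open>Congruence, positive definiteness and unitary diagonalization\<close>

lemma qform_congruence: "qform (adj C ** A ** C) x = qform A (C *v x)"
  by (simp add: qform_def mat2_simps algebra_simps)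

lemma qform_diagm: "Re (qform (diagm l) x) = l $ 1 * (cmod (x $ 1))\<^sup>2 + l $ 2 * (cmod (x $ 2))\<^sup>2"
  by (simp add: qform_def mat2_simps cmod_power2) (simp add: power2_eq_square algebra_simps)

lemma posdef_congruence:
  assumes "posdef A" and "D ** C = mat 1"
  shows "posdef (adj C ** A ** C)"
proof -
  have "C *v x \<noteq> 0" if "x \<noteq> 0" for x
    using that assms(2) by (metis matrix_vector_mul_assoc matrix_vector_mul_lid matrix_vector_mult_0_right)
  then show ?thesis
    using assms(1) by (simp add: posdef_def hermitian_def adj_mult matrix_mul_assoc qform_congruence)
qed

lemma posdef_diagm: "(\<And>i. 0 < l $ i) \<Longrightarrow> posdef (diagm l)"
  unfolding posdef_def hermitian_def qform_diagm
  by (auto simp: vec_eq_iff forall_2 less_imp_le intro: add_pos_nonneg add_nonneg_pos)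

lemma posdef_spectral_form:
  assumes "unitary U" and "\<And>i. 0 < l $ i"
  shows "posdef (U ** diagm l ** adj U)"
  using posdef_congruence[OF posdef_diagm, of l "U" "adj U"] assms
  by (simp add: unitary_right)

lemma unitary_diagonalization:
  assumes "hermitian A"
  obtains U l where "unitary U" "A = U ** diagm l ** adj U"
proof (cases "A $ 1 $ 2 = 0")
  case True
  have h: "cnj (A $ j $ i) = A $ i $ j" for i j
    using assms by (simp add: hermitian_def adj_def vec_eq_iff)
  have "A = mat 1 ** diagm (\<chi> i. Re (A $ i $ i)) ** adj (mat 1)"
    using True h[of 1 1] h[of 2 2] h[of 2 1]
    by (simp add: mat2_simps complex_eq_iff)
  then show thesis by (intro that[of "mat 1"]) (simp_all add: unitary_def)
next
  case False
  have h: "cnj (A $ j $ i) = A $ i $ j" for i j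
    using assms by (simp add: hermitian_def adj_def vec_eq_iff)
  define a d z where "a = Re (A $ 1 $ 1)" "d = Re (A $ 2 $ 2)" "z = A $ 1 $ 2"
  have A: "A $ 1 $ 1 = of_real a" "A $ 2 $ 2 = of_real d" "A $ 1 $ 2 = z" "A $ 2 $ 1 = cnj z"
    using h[of 1 1] h[of 2 2] h[of 2 1] by (simp_all add: a_d_z_def complex_eq_iff)
  define r where "r = sqrt ((a - d)\<^sup>2 + 4 * (cmod z)\<^sup>2)"
  \<comment> \<open>A root of \<open>m^2 = (d - a) * m + |z|^2\<close>. The eigenvalues are then
    \<open>a + m\<close> and \<open>d - m\<close>, with orthogonal eigenvectors
    \<open>(z, m)\<close> and \<open>(-m, cnj z)\<close> of common length \<open>n\<close>.\<close>
  define m where "m = (d - a + r) / 2"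
  have r: "r\<^sup>2 = (a - d)\<^sup>2 + 4 * (cmod z)\<^sup>2" unfolding r_def by simp
  have m: "m\<^sup>2 = (d - a) * m + (cmod z)\<^sup>2"
    using r unfolding m_def by (simp add: power2_eq_square field_simps)
  define n where "n = sqrt ((cmod z)\<^sup>2 + m\<^sup>2)"
  have npos: "n > 0" unfolding n_def using False by (simp add: a_d_z_def add_pos_nonneg)
  have n: "n\<^sup>2 = (cmod z)\<^sup>2 + m\<^sup>2" unfolding n_def by simp
  have zz: "cnj z * z = of_real (n\<^sup>2 - m\<^sup>2)" "z * cnj z = of_real (n\<^sup>2 - m\<^sup>2)"
    using n by (simp_all add: complex_norm_square[symmetric] mult.commute[of "cnj z"])
  define U :: cmat2 where "U = (\<chi> i j. if i = 1 then (if j = 1 then z / of_real n else - of_real (m / n))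
     else (if j = 1 then of_real (m / n) else cnj z / of_real n))"
  define l :: "real^2" where "l = (\<chi> i. if i = 1 then a + m else d - m)"
  have U: "unitary U"
    using npos zz unfolding unitary_def U_def
    by (simp add: mat2_simps field_simps power2_eq_square)
  have "A ** U = U ** diagm l"
  proof -
    have "z * cnj z = of_real (m\<^sup>2 - (d - a) * m)"
      using m by (simp add: complex_norm_square[symmetric])
    then have "z * cnj z = of_real m * of_real m - (of_real d - of_real a) * of_real m"
      by (simp add: power2_eq_square)
    then show ?thesis using npos unfolding U_def l_def
      by (simp add: mat2_simps A field_simps)
  qed
  then have "A = U ** diagm l ** adj U"
    using unitary_right[OF U] by (metis matrix_mul_assoc matrix_mul_rid)
  with U show thesis by (rule that)
qed

lemma posdef_diagonalization:
  assumes "posdef A"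
  obtains U l where "unitary U" "\<And>i. 0 < l $ i" "A = U ** diagm l ** adj U"
proof -
  obtain U l where U: "unitary U" and A: "A = U ** diagm l ** adj U"
    using assms unitary_diagonalization posdef_def by metis
  have D: "diagm l = adj U ** A ** U"
    using U unfolding A unitary_def by (metis matrix_mul_assoc matrix_mul_lid matrix_mul_rid)
  have "posdef (diagm l)"
    unfolding D by (rule posdef_congruence[OF assms, of "adj U"]) (use U in \<open>simp add: unitary_def\<close>)
  then have p: "0 < Re (qform (diagm l) (axis i 1))" for i
    unfolding posdef_def by (simp add: axis_eq_0_iff)
  have "0 < l $ i" for i
    using p[of i] exhaust_2[of i] unfolding qform_diagm by (auto simp: axis_def)
  with U A show thesis by (intro that)
qed

section \<open>Laws of exponents for real powers\<close>

lemma mpow_posdef: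
  assumes "posdef A"
  shows "posdef (mpow A t)"
proof -
  obtain U l where *: "unitary U" "\<And>i. 0 < l $ i" "A = U ** diagm l ** adj U"
    using posdef_diagonalization[OF assms] by blast
  then show ?thesis
    using posdef_spectral_form[OF *(1), of "\<chi> i. l $ i powr t"] less_imp_neq[OF *(2), symmetric]
    by (simp add: mpow_spectral)
qed

lemma mpow_mpow:
  assumes "posdef A"
  shows "mpow (mpow A s) t = mpow A (s * t)"
proof -
  obtain U l where *: "unitary U" "\<And>i. 0 < l $ i" "A = U ** diagm l ** adj U"
    using posdef_diagonalization[OF assms] by blast
  then show ?thesis
    using mpow_spectral[OF *(1), of "\<chi> i. l $ i powr s" t] less_imp_neq[OF *(2), symmetric]
    by (simp add: mpow_spectral powr_powr)
qed

lemma mpow_1: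
  assumes "posdef A"
  shows "mpow A 1 = A"
proof -
  obtain U l where *: "unitary U" "\<And>i. 0 < l $ i" "A = U ** diagm l ** adj U"
    using posdef_diagonalization[OF assms] by blast
  moreover have "(\<chi> i. l $ i powr 1) = l" using *(2) by (simp add: vec_eq_iff less_imp_le)
  ultimately show ?thesis by (simp add: mpow_spectral)
qed

lemma mpow_0:
  assumes "posdef A"
  shows "mpow A 0 = mat 1"
proof -
  obtain U l where *: "unitary U" "\<And>i. 0 < l $ i" "A = U ** diagm l ** adj U"
    using posdef_diagonalization[OF assms] by blast
  moreover have "(\<chi> i. l $ i powr 0) = (\<chi> i. 1)" using *(2) by (simp add: vec_eq_iff less_imp_neq[symmetric])
  ultimately show ?thesis by (simp add: mpow_spectral unitary_right)
qed

lemma mpow_add: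
  assumes "posdef A"
  shows "mpow A s ** mpow A t = mpow A (s + t)"
proof -
  obtain U l where *: "unitary U" "\<And>i. 0 < l $ i" "A = U ** diagm l ** adj U"
    using posdef_diagonalization[OF assms] by blast
  then show ?thesis
    by (simp add: mpow_spectral unitary_conj_mult diagm_mult powr_add)
qed

lemma mpow_diagm:
  assumes "\<And>i. 0 < l $ i"
  shows "mpow (diagm l) t = diagm (\<chi> i. l $ i powr t)"
  using mpow_spectral[of "mat 1" l t] assms by (simp add: unitary_def)

lemma posdef_adj: "posdef A \<Longrightarrow> adj A = A"
  by (simp add: posdef_def hermitian_def)

lemma mpow_minus_mult:
  assumes "posdef A"
  shows "mpow A (- t) ** mpow A t = mat 1" "mpow A t ** mpow A (- t) = mat 1"
  using mpow_add[OF assms] mpow_0[OF assms] by simp_all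

lemma posdef_inv:
  assumes "posdef A"
  shows "matrix_inv A = mpow A (-1)"
proof -
  have *: "mpow A (-1) ** A = mat 1" "A ** mpow A (-1) = mat 1"
    using mpow_minus_mult[OF assms, of 1] by (simp_all add: mpow_1 assms)
  then have "A ** matrix_inv A = mat 1"
    unfolding matrix_inv_def by (metis (mono_tags, lifting) someI_ex)
  with * show ?thesis by (metis matrix_mul_assoc matrix_mul_lid matrix_mul_rid)
qed

lemma posdef_sandwich:
  assumes "posdef K" "posdef A"
  shows "posdef (K ** A ** K)"
  using posdef_congruence[OF assms(2), of "mpow K (-1)" K] mpow_minus_mult[OF assms(1), of 1]
  by (simp add: posdef_adj mpow_1 assms)

lemma posdef_sqrt_unique:
  assumes "posdef K"
  shows "mpow (K ** K) (1/2) = K"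
proof -
  have "K ** K = mpow K 2" using mpow_add[OF assms, of 1 1] by (simp add: mpow_1 assms)
  then show ?thesis by (simp add: mpow_mpow mpow_1 assms)
qed

section \<open>The geometric mean as a solution of a Riccati equation\<close>

lemma posdef_gmean:
  assumes "posdef A" "posdef B"
  shows "posdef (gmean A B)"
  unfolding gmean_def by (intro posdef_sandwich mpow_posdef assms)

text \<open>Between the two means the factors \<open>?R\<close> and \<open>?S\<close> cancel,
  leaving the square of the middle root, which is \<open>?N\<close>. This equation later recovers
  \<open>Y\<close> from \<open>K = X # Y^(-1)\<close>.\<close>

lemma gmean_riccati:
  assumes A: "posdef A" and B: "posdef B"
  shows "gmean A B ** mpow A (-1) ** gmean A B = B"
proof -
  let ?R = "mpow A (1/2)" and ?S = "mpow A (-1/2)"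
  let ?N = "?S ** B ** ?S"
  let ?M = "mpow ?N (1/2)"
  have N: "posdef ?N" by (intro posdef_sandwich mpow_posdef assms)
  have RS: "?R ** ?S = mat 1" "?S ** ?R = mat 1"
    using mpow_minus_mult[OF A, of "1/2"] by simp_all
  have i: "mpow A (-1) = ?S ** ?S" using mpow_add[OF A, of "-1/2" "-1/2"] by simp
  have M: "?M ** ?M = ?N" using mpow_add[OF N, of "1/2" "1/2"] mpow_1[OF N] by simp
  have "gmean A B ** mpow A (-1) ** gmean A B = ?R ** ?M ** (?R ** ?S) ** (?S ** ?R) ** ?M ** ?R"
    unfolding gmean_def i by (simp only: matrix_mul_assoc)
  also have "\<dots> = ?R ** (?M ** ?M) ** ?R"
    unfolding RS by (simp add: matrix_mul_assoc)
  also have "\<dots> = (?R ** ?S) ** B ** (?S ** ?R)"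
    unfolding M by (simp only: matrix_mul_assoc)
  finally show ?thesis unfolding RS by simp
qed

text \<open>Conjugating \<open>G ** A ** G\<close> by \<open>A^(1/2)\<close> gives the square of the
  positive definite matrix \<open>A^(1/2) G A^(1/2)\<close>, whose root is therefore known.
  Consequently every positive definite \<open>G\<close> occurs as a mean of \<open>A^(-1)\<close>
  and some \<open>B\<close>.\<close>

lemma gmean_inv_sandwich:
  assumes A: "posdef A" and G: "posdef G"
  shows "gmean (matrix_inv A) (G ** A ** G) = G"
proof -
  let ?R = "mpow A (1/2)" and ?S = "mpow A (-1/2)"
  have RS: "?R ** ?S = mat 1" "?S ** ?R = mat 1"
    using mpow_minus_mult[OF A, of "1/2"] by simp_all
  have RR: "?R ** ?R = A" using mpow_add[OF A, of "1/2" "1/2"] by (simp add: mpow_1 A)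
  have K: "posdef (?R ** G ** ?R)" by (intro posdef_sandwich mpow_posdef A G)
  have "?R ** (G ** A ** G) ** ?R = (?R ** G ** ?R) ** (?R ** G ** ?R)"
    by (subst (2) RR[symmetric]) (simp only: matrix_mul_assoc)
  then have "mpow (?R ** (G ** A ** G) ** ?R) (1/2) = ?R ** G ** ?R"
    by (simp add: posdef_sqrt_unique[OF K])
  then have "gmean (matrix_inv A) (G ** A ** G) = ?S ** (?R ** G ** ?R) ** ?S"
    by (simp add: gmean_def posdef_inv mpow_mpow A)
  also have "\<dots> = (?S ** ?R) ** G ** (?R ** ?S)" by (simp only: matrix_mul_assoc)
  finally show ?thesis unfolding RS by simp
qed

lemma Fa_sandwich:
  assumes "posdef A" "posdef G"
  shows "Fa \<alpha> A (G ** A ** G) = mpow G \<alpha> ** A ** mpow G \<alpha>"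
  using gmean_inv_sandwich[OF assms] by (simp add: Fa_def)

section \<open>The trace inequality implied by the near order\<close>

lemma trace_unitary_conj:
  assumes "unitary U"
  shows "trace (U ** X ** adj U) = trace X"
  using assms unfolding unitary_def by (metis trace_mul_sym matrix_mul_assoc matrix_mul_lid)

text \<open>With \<open>J = K^(-1)\<close> the right side is the trace of
  \<open>(X ** J) ** (X ** J)\<close>. In an eigenbasis of \<open>X\<close> it equals the sum of
  \<open>x_i^2 * L_ii^2\<close> plus a nonnegative off-diagonal term, and
  \<open>L_ii \<ge> 1\<close> because the eigenvalues of \<open>K\<close> are at most 1.\<close>

lemma near_le_trace:
  assumes X: "posdef X" and Y: "posdef Y" and le: "near_le X Y"
  shows "Re (trace (X ** X)) \<le> Re (trace (X ** Y))"
proof -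
  define K where "K = gmean X (matrix_inv Y)"
  have Yi: "posdef (matrix_inv Y)" by (simp add: posdef_inv mpow_posdef Y)
  have K: "posdef K" unfolding K_def by (rule posdef_gmean[OF X Yi])
  obtain V k where V: "unitary V" and k: "\<And>i. 0 < k $ i" and KV: "K = V ** diagm k ** adj V"
    using posdef_diagonalization[OF K] by blast
  obtain U x where U: "unitary U" and x: "\<And>i. 0 < x $ i" and XU: "X = U ** diagm x ** adj U"
    using posdef_diagonalization[OF X] by blast
  \<comment> \<open>The form of \<open>mat 1 - K\<close> is evaluated at the \<open>i\<close>-th
    eigenvector of \<open>K\<close>.\<close>
  have k1: "k $ i \<le> 1" for i
  proof -
    have "0 \<le> Re (qform (mat 1 - K) (V *v axis i 1))"
      using le unfolding near_le_def loewner_le_def possemidef_def K_def by blast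
    also have "\<dots> = Re (qform (adj V ** (mat 1 - K) ** V) (axis i 1))"
      by (simp add: qform_congruence)
    also have "adj V ** (mat 1 - K) ** V = mat 1 - diagm k"
    proof -
      have "adj V ** (mat 1 - K) ** V = adj V ** V - adj V ** K ** V"
        by (simp add: mat2_simps algebra_simps)
      also have "adj V ** K ** V = (adj V ** V) ** diagm k ** (adj V ** V)"
        unfolding KV by (simp only: matrix_mul_assoc)
      finally show ?thesis using V by (simp add: unitary_def)
    qed
    also have "\<dots> = diagm (\<chi> i. 1 - k $ i)" by (simp add: mat2_simps)
    also have "Re (qform \<dots> (axis i 1)) = 1 - k $ i"
      using exhaust_2[of i] unfolding qform_diagm by (auto simp: axis_def)
    finally show ?thesis by simp
  qed
  define J where "J = mpow K (-1)"
  have JK: "J ** K = mat 1" "K ** J = mat 1"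
    using mpow_minus_mult[OF K, of 1] by (simp_all add: J_def mpow_1 K)
  have JV: "J = V ** diagm (\<chi> i. 1 / k $ i) ** adj V"
    using mpow_spectral[OF V k, of "-1"] k by (simp add: J_def KV powr_minus_divide less_imp_le)
  have XX: "mpow X (-1) ** X = mat 1" "Y ** mpow Y (-1) = mat 1"
    using mpow_minus_mult[OF X, of 1] mpow_minus_mult[OF Y, of 1] by (simp_all add: mpow_1 X Y)
  \<comment> \<open>The Riccati equation reads \<open>K X^(-1) K = Y^(-1)\<close>, so
    \<open>J ** X ** J\<close> is a right inverse of \<open>Y^(-1)\<close>.\<close>
  have "mpow Y (-1) ** (J ** X ** J) = (K ** mpow X (-1) ** K) ** (J ** X ** J)"
    using gmean_riccati[OF X Yi] by (simp add: K_def posdef_inv Y)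
  also have "\<dots> = K ** (mpow X (-1) ** (K ** J) ** X) ** J" by (simp only: matrix_mul_assoc)
  also have "\<dots> = mat 1" by (simp add: JK XX)
  finally have YJ: "Y = J ** X ** J"
    using XX(2) by (metis matrix_mul_assoc matrix_mul_lid matrix_mul_rid)
  \<comment> \<open>\<open>L\<close> is the matrix of \<open>J\<close> in the eigenbasis of
    \<open>X\<close>.\<close>
  define W where "W = adj V ** U"
  define L where "L = adj W ** diagm (\<chi> i. 1 / k $ i) ** W"
  have W: "unitary W" unfolding W_def using V U by (simp add: unitary_adj unitary_mult)
  have JL: "J = U ** L ** adj U"
    unfolding JV L_def W_def adj_mult using unitary_right[OF U]
    by (simp add: matrix_mul_assoc) (metis matrix_mul_assoc matrix_mul_rid)
  have Lh: "L $ 2 $ 1 = cnj (L $ 1 $ 2)"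
    unfolding L_def by (simp add: mat2_simps algebra_simps)
  have Lr: "Im (L $ i $ i) = 0" for i
    unfolding L_def by (simp add: mat2_simps algebra_simps)
  \<comment> \<open>\<open>L $ i $ i\<close> is an average of the numbers \<open>1 / k $ j\<close>,
    each at least 1, with weights \<open>|W $ j $ i|^2\<close> that sum to 1.\<close>
  have L1: "1 \<le> Re (L $ i $ i)" for i
  proof -
    have "(adj W ** W) $ i $ i = 1" using W by (simp add: unitary_def mat_def)
    then have "1 = Re ((adj W ** W) $ i $ i)" by simp
    also have "\<dots> = (cmod (W $ 1 $ i))\<^sup>2 + (cmod (W $ 2 $ i))\<^sup>2"
      by (simp add: mat2_simps cmod_power2) (simp add: power2_eq_square)
    also have "\<dots> \<le> (cmod (W $ 1 $ i))\<^sup>2 / k $ 1 + (cmod (W $ 2 $ i))\<^sup>2 / k $ 2"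
    proof -
      have "(cmod (W $ j $ i))\<^sup>2 \<le> (cmod (W $ j $ i))\<^sup>2 / k $ j" for j
        using k[of j] k1[of j] by (simp add: field_simps mult_left_le_one_le)
      then show ?thesis by (intro add_mono)
    qed
    also have "\<dots> = Re (L $ i $ i)"
      unfolding L_def cmod_power2 by (simp add: mat2_simps power2_eq_square field_simps)
    finally show ?thesis .
  qed
  have XJ: "X ** J = U ** (diagm x ** L) ** adj U"
    unfolding XU JL by (rule unitary_conj_mult[OF U])
  have "X ** Y = (X ** J) ** (X ** J)" by (simp only: YJ matrix_mul_assoc)
  then have "trace (X ** Y) = trace (diagm x ** L ** (diagm x ** L))"
    unfolding XJ unitary_conj_mult[OF U] by (simp only: trace_unitary_conj[OF U])
  then have t1: "Re (trace (X ** Y)) = (x $ 1)\<^sup>2 * (Re (L $ 1 $ 1))\<^sup>2 + (x $ 2)\<^sup>2 * (Re (L $ 2 $ 2))\<^sup>2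
      + 2 * x $ 1 * x $ 2 * (cmod (L $ 1 $ 2))\<^sup>2"
    using Lr[of 1] Lr[of 2]
    by (simp add: trace_def mat2_simps Lh cmod_power2) (simp add: power2_eq_square algebra_simps)
  have t2: "Re (trace (X ** X)) = (x $ 1)\<^sup>2 + (x $ 2)\<^sup>2"
    unfolding XU unitary_conj_mult[OF U] trace_unitary_conj[OF U]
    by (simp add: trace_def mat2_simps power2_eq_square)
  have "(x $ i)\<^sup>2 \<le> (x $ i)\<^sup>2 * (Re (L $ i $ i))\<^sup>2" for i
    using L1[of i] by (simp add: mult_le_cancel_left1 one_le_power)
  moreover have "0 \<le> 2 * x $ 1 * x $ 2 * (cmod (L $ 1 $ 2))\<^sup>2"
    using x by (simp add: less_imp_le)
  ultimately show ?thesis unfolding t1 t2 by (smt (verit))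
qed

section \<open>Limits of powers at singular matrices\<close>

lemma posdef_convex:
  assumes "posdef A" "posdef B" "0 < b" "b < 1"
  shows "posdef ((1 - b) *\<^sub>R A + b *\<^sub>R B)"
proof -
  have "adj ((1 - b) *\<^sub>R A + b *\<^sub>R B) = (1 - b) *\<^sub>R adj A + b *\<^sub>R adj B"
    by (simp add: mat2_simps)
  moreover have "qform ((1 - b) *\<^sub>R A + b *\<^sub>R B) x = (1 - b) *\<^sub>R qform A x + b *\<^sub>R qform B x" for x
    by (simp add: qform_def mat2_simps algebra_simps)
  ultimately show ?thesis
    using assms by (auto simp: posdef_def hermitian_def intro!: add_pos_pos)
qed

text \<open>
  The Lagrange interpolation of \<open>x powr t\<close> at two distinct eigenvalues. Unlike \<^const>\<open>mpow\<close>, which is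
  unspecified off the positive definite matrices, it is continuous up to singular matrices.
\<close>

definition eig_gap :: "cmat2 \<Rightarrow> real" where
  "eig_gap M = sqrt ((Re (trace M))\<^sup>2 - 4 * Re (det M))"

definition eig_max :: "cmat2 \<Rightarrow> real" where
  "eig_max M = (Re (trace M) + eig_gap M) / 2"

definition eig_min :: "cmat2 \<Rightarrow> real" where
  "eig_min M = (Re (trace M) - eig_gap M) / 2"

definition interp_pow :: "cmat2 \<Rightarrow> real \<Rightarrow> cmat2" where
  "interp_pow M t =
     ((eig_max M powr t - eig_min M powr t) / eig_gap M) *\<^sub>R M +
     ((eig_max M * eig_min M powr t - eig_min M * eig_max M powr t) / eig_gap M) *\<^sub>R mat 1"

text \<open>The eigenvalues are read off from trace and determinant. The linear polynomial with the
  two coefficients of \<open>interp_pow\<close> agrees with \<open>x powr t\<close> at both, so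
  applying it to \<open>M\<close> gives the power.\<close>

lemma mpow_eq_interp_pow:
  assumes M: "posdef M" and gap: "eig_gap M \<noteq> 0"
  shows "mpow M t = interp_pow M t" and "0 < eig_min M" and "0 < eig_max M"
proof -
  obtain U l where U: "unitary U" and l: "\<And>i. 0 < l $ i" and MU: "M = U ** diagm l ** adj U"
    using posdef_diagonalization[OF M] by blast
  have tr: "Re (trace M) = l $ 1 + l $ 2"
    unfolding MU trace_unitary_conj[OF U] by (simp add: trace_def mat2_simps)
  have "det (adj U) * det U = 1"
    using U by (metis det_I det_mul unitary_def)
  then have "det M = det (diagm l)"
    unfolding MU by (simp add: det_mul mult.commute mult.left_commute)
  then have dt: "Re (det M) = l $ 1 * l $ 2" by (simp add: det_2 diagm_def)
  have "(Re (trace M))\<^sup>2 - 4 * Re (det M) = (l $ 1 - l $ 2)\<^sup>2"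
    unfolding tr dt by (simp add: power2_eq_square algebra_simps)
  then have g: "eig_gap M = \<bar>l $ 1 - l $ 2\<bar>" unfolding eig_gap_def by simp
  have ne: "l $ 1 \<noteq> l $ 2" using gap g by auto
  have ev: "eig_max M = max (l $ 1) (l $ 2)" "eig_min M = min (l $ 1) (l $ 2)"
    unfolding eig_max_def eig_min_def g tr by (auto simp: field_simps max_def min_def)
  show "0 < eig_min M" "0 < eig_max M" using l ev by (auto simp: less_max_iff_disj)
  define c1 where "c1 = (eig_max M powr t - eig_min M powr t) / eig_gap M"
  define c0 where "c0 = (eig_max M * eig_min M powr t - eig_min M * eig_max M powr t) / eig_gap M"
  have "c1 * l $ i + c0 = l $ i powr t" for i
  proof -
    have "(eig_max M powr t - eig_min M powr t) * l $ i +
        (eig_max M * eig_min M powr t - eig_min M * eig_max M powr t) = l $ i powr t * eig_gap M"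
      unfolding g ev using exhaust_2[of i] by (auto simp: max_def min_def algebra_simps)
    then have "c1 * l $ i + c0 = (l $ i powr t * eig_gap M) / eig_gap M"
      unfolding c1_def c0_def times_divide_eq_left add_divide_distrib[symmetric] by simp
    also have "\<dots> = l $ i powr t" using gap by simp
    finally show ?thesis .
  qed
  then have "diagm (\<chi> i. l $ i powr t) = c1 *\<^sub>R diagm l + c0 *\<^sub>R mat 1"
    by (simp add: mat2_simps scaleR_conv_of_real[where 'a = complex] flip: of_real_mult of_real_add)
  then have "mpow M t = U ** (c1 *\<^sub>R diagm l + c0 *\<^sub>R mat 1) ** adj U"
    unfolding MU using mpow_spectral[OF U l] by simp
  also have "\<dots> = c1 *\<^sub>R M + c0 *\<^sub>R (U ** adj U)"
    unfolding MU by (simp add: mat2_simps algebra_simps)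
  finally show "mpow M t = interp_pow M t"
    using unitary_right[OF U] by (simp add: interp_pow_def c1_def c0_def)
qed

lemma tendsto_matrix_mult:
  fixes A B :: "'a \<Rightarrow> cmat2"
  assumes "(A \<longlongrightarrow> a) F" "(B \<longlongrightarrow> b) F"
  shows "((\<lambda>x. A x ** B x) \<longlongrightarrow> a ** b) F"
  unfolding matrix_matrix_mult_def by (intro tendsto_intros assms)

lemma tendsto_Re_trace:
  fixes A :: "'a \<Rightarrow> cmat2"
  assumes "(A \<longlongrightarrow> a) F"
  shows "((\<lambda>x. Re (trace (A x))) \<longlongrightarrow> Re (trace a)) F"
  unfolding trace_def by (intro tendsto_intros assms)

text \<open>The hypothesis on \<open>N\<close> makes \<open>eig_gap N\<close> positive, so the
  interpolation formula is continuous there. Since \<open>t > 0\<close>, the function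
  \<open>x powr t\<close> stays continuous at an eigenvalue 0, approached through positive
  values.\<close>

lemma tendsto_mpow:
  assumes lim: "(M \<longlongrightarrow> N) F" and pd: "\<forall>\<^sub>F x in F. posdef (M x)"
    and gap: "4 * Re (det N) < (Re (trace N))\<^sup>2" and t: "0 < t"
  shows "((\<lambda>x. mpow (M x) t) \<longlongrightarrow> interp_pow N t) F"
proof -
  have g: "((\<lambda>x. eig_gap (M x)) \<longlongrightarrow> eig_gap N) F"
    unfolding eig_gap_def det_2 by (intro tendsto_intros tendsto_Re_trace lim)
  have g0: "0 < eig_gap N" unfolding eig_gap_def using gap by simp
  have ev: "((\<lambda>x. eig_max (M x)) \<longlongrightarrow> eig_max N) F" "((\<lambda>x. eig_min (M x)) \<longlongrightarrow> eig_min N) F"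
    unfolding eig_max_def eig_min_def by (intro tendsto_intros tendsto_Re_trace g lim; simp)+
  have "\<forall>\<^sub>F x in F. 0 < eig_gap (M x)"
    using g g0 by (rule order_tendstoD)
  with pd have good: "\<forall>\<^sub>F x in F. mpow (M x) t = interp_pow (M x) t \<and> 0 < eig_min (M x) \<and> 0 < eig_max (M x)"
    by eventually_elim (simp add: mpow_eq_interp_pow)
  have pw: "((\<lambda>x. eig_max (M x) powr t) \<longlongrightarrow> eig_max N powr t) F"
    "((\<lambda>x. eig_min (M x) powr t) \<longlongrightarrow> eig_min N powr t) F"
    using t good by (auto intro!: tendsto_powr' ev elim: eventually_mono)
  have "((\<lambda>x. interp_pow (M x) t) \<longlongrightarrow> interp_pow N t) F"
    unfolding interp_pow_def using g0 by (intro tendsto_intros pw ev g lim) auto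
  moreover have "\<forall>\<^sub>F x in F. interp_pow (M x) t = mpow (M x) t"
    using good by eventually_elim simp
  ultimately show ?thesis by (rule Lim_transform_eventually)
qed

text \<open>Here \<open>eig_max M\<close> is the real trace and \<open>eig_min M\<close> is 0; as
  \<open>0 powr t = 0\<close>, only the linear term survives.\<close>

lemma interp_pow_rank_one:
  assumes "det M = 0" "Re (trace M) > 0"
  shows "interp_pow M t = (Re (trace M) powr t / Re (trace M)) *\<^sub>R M"
proof -
  have g: "eig_gap M = Re (trace M)" unfolding eig_gap_def using assms by simp
  show ?thesis unfolding interp_pow_def eig_max_def eig_min_def g by simp
qed

section \<open>The necessary condition on the exponents\<close>

text \<open>The trace inequality is taken to the limit along \<open>A h\<close> and
  \<open>G h\<close> as \<open>h\<close> decreases to 0. \<open>S\<close> is the limit of the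
  weighted sum under the outer power. The weight \<open>b\<close> is kept general so that it can
  later be both \<open>\<alpha>\<close> and \<open>1 - \<alpha>\<close>.\<close>

lemma near_mean_limit:
  fixes b c s p q r :: real
  assumes b: "0 < b" "b < 1" and p: "0 < p" and q: "0 < q" and r: "0 < r"
    and c: "0 < c" "0 < s" "c\<^sup>2 + s\<^sup>2 = 1"
    and near: "\<And>A G. posdef A \<Longrightarrow> posdef G \<Longrightarrow> near_le (mpow (mpow G b ** A ** mpow G b) (1/p))
        (mpow ((1 - b) *\<^sub>R mpow A r + b *\<^sub>R mpow (G ** A ** G) r) (1/q))"
  defines "S \<equiv> (\<chi> i j. of_real (if i = 1 then (if j = 1 then (1 - b) * c\<^sup>2 + b else (1 - b) * c * s)
      else (if j = 1 then (1 - b) * c * s else (1 - b) * s\<^sup>2))) :: cmat2"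
  shows "(c\<^sup>2) powr ((1 - b) / p) \<le> Re (interp_pow S (1/q) $ 1 $ 1)"
proof -
  define U :: cmat2 where "U = (\<chi> i j. of_real (if i = 1 then (if j = 1 then c else -s) else (if j = 1 then s else c)))"
  have U: "unitary U"
    unfolding unitary_def U_def using c(3)
    by (simp add: mat2_simps power2_eq_square add.commute flip: of_real_mult of_real_add)
  define d :: "real \<Rightarrow> real \<Rightarrow> real^2" where "d x y = (\<chi> i. if i = 1 then x else y)" for x y
  have d: "0 < d x y $ i" if "0 < x" "0 < y" for x y i using that by (simp add: d_def)
  have d_lim: "((\<lambda>h. diagm (d x (f h))) \<longlongrightarrow> diagm (d x y)) F" if "(f \<longlongrightarrow> y) F" for x y f and F :: "real filter"
  proof -
    have "((\<lambda>h. diagm (d x (f h)) $ i $ j) \<longlongrightarrow> diagm (d x y) $ i $ j) F" for i j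
      using that by (simp add: diagm_def d_def tendsto_intros)
    then show ?thesis by (intro vec_tendstoI)
  qed
  define A where "A h = U ** diagm (d 1 h) ** adj U" for h
  define G where "G h = diagm (d (1/c) h)" for h
  define Gb where "Gb h = diagm (d ((1/c) powr b) (h powr b))" for h
  define A0 where "A0 = U ** diagm (d 1 0) ** adj U"
  define f where "f = (c\<^sup>2) powr (1 - b)"
  have pA: "posdef (A h)" if "0 < h" for h
    unfolding A_def by (intro posdef_spectral_form U d that) simp
  have pG: "posdef (G h)" if "0 < h" for h
    unfolding G_def using that c by (intro posdef_diagm d) auto
  have Gb: "mpow (G h) b = Gb h" if "0 < h" for h
  proof -
    have "(\<chi> i. d (1/c) h $ i powr b) = d ((1/c) powr b) (h powr b)"
      by (simp add: d_def vec_eq_iff)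
    then show ?thesis unfolding G_def Gb_def
      using mpow_diagm[of "d (1/c) h" b] d[of "1/c" h] that c by simp
  qed
  have ev: "\<forall>\<^sub>F h in at_right 0. (0::real) < h"
    by (rule eventually_at_right_less)
  have lim_id: "((\<lambda>h. h) \<longlongrightarrow> (0::real)) (at_right 0)" by (rule tendsto_ident_at)
  have lim_pow: "((\<lambda>h. h powr b) \<longlongrightarrow> (0::real)) (at_right 0)" 
    using tendsto_powr'[OF lim_id tendsto_const, of b] b eventually_mono[OF ev, of "(\<le>) 0"] by simp
  have lA: "(A \<longlongrightarrow> A0) (at_right 0)"
    unfolding A_def A0_def by (intro tendsto_matrix_mult tendsto_const d_lim lim_id)
  have lG: "(G \<longlongrightarrow> diagm (d (1/c) 0)) (at_right 0)"
    unfolding G_def by (intro d_lim lim_id)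
  have lGb: "(Gb \<longlongrightarrow> diagm (d ((1/c) powr b) 0)) (at_right 0)"
    unfolding Gb_def by (intro d_lim lim_pow)
  have A0: "A0 = (\<chi> i j. of_real (if i = 1 then (if j = 1 then c\<^sup>2 else c * s)
      else (if j = 1 then c * s else s\<^sup>2)))"
    unfolding A0_def U_def d_def by (simp add: mat2_simps power2_eq_square)
  \<comment> \<open>The factor \<open>1/c\<close> is chosen to rescale the corner entry
    \<open>c^2\<close> of \<open>A0\<close> to 1.\<close>
  have "diagm (d (1/c) 0) ** A0 ** diagm (d (1/c) 0) = diagm (d 1 0)"
    unfolding A0 d_def using c by (simp add: mat2_simps power2_eq_square)
  with tendsto_matrix_mult[OF tendsto_matrix_mult[OF lG lA] lG]
  have lB: "((\<lambda>h. G h ** A h ** G h) \<longlongrightarrow> diagm (d 1 0)) (at_right 0)" by simp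
  have "((1/c) powr b)\<^sup>2 * c\<^sup>2 = f"
  proof -
    have "((1/c) powr b)\<^sup>2 * c\<^sup>2 = c powr (- b) * c powr (- b) * (c powr 1 * c powr 1)"
      using c by (simp add: power2_eq_square powr_divide powr_minus_divide)
    also have "\<dots> = c powr ((1 - b) + (1 - b))" unfolding powr_add[symmetric] by simp
    also have "\<dots> = f" unfolding f_def power2_eq_square powr_add using c by (simp add: powr_mult)
    finally show ?thesis .
  qed
  then have "diagm (d ((1/c) powr b) 0) ** A0 ** diagm (d ((1/c) powr b) 0) = diagm (d f 0)"
    unfolding A0 d_def by (simp add: mat2_simps power2_eq_square mult_ac flip: of_real_mult)
  with tendsto_matrix_mult[OF tendsto_matrix_mult[OF lGb lA] lGb]
  have lF: "((\<lambda>h. Gb h ** A h ** Gb h) \<longlongrightarrow> diagm (d f 0)) (at_right 0)" by simp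
  define X where "X h = mpow (Gb h ** A h ** Gb h) (1/p)" for h
  define Z where "Z h = (1 - b) *\<^sub>R mpow (A h) r + b *\<^sub>R mpow (G h ** A h ** G h) r" for h
  define Y where "Y h = mpow (Z h) (1/q)" for h
  have f0: "0 < f" unfolding f_def using c by simp
  have pF: "posdef (Gb h ** A h ** Gb h)" if "0 < h" for h
    using Gb[OF that] pA[OF that] pG[OF that] by (metis mpow_posdef posdef_sandwich)
  have pB: "posdef (G h ** A h ** G h)" if "0 < h" for h
    using pA[OF that] pG[OF that] by (intro posdef_sandwich)
  have pZ: "posdef (Z h)" if "0 < h" for h
    unfolding Z_def using pA[OF that] pB[OF that] b by (intro posdef_convex mpow_posdef) auto
  define X0 where "X0 = (f powr (1/p) / f) *\<^sub>R diagm (d f 0)"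
  have lX: "(X \<longlongrightarrow> X0) (at_right 0)"
  proof -
    have e: "det (diagm (d f 0)) = 0" "Re (trace (diagm (d f 0))) = f"
      by (simp_all add: det_2 trace_def sum_2 diagm_def d_def)
    have "(X \<longlongrightarrow> interp_pow (diagm (d f 0)) (1/p)) (at_right 0)"
      unfolding X_def using e f0 p
      by (intro tendsto_mpow lF eventually_mono[OF ev pF]) auto
    then show ?thesis using e f0 by (simp add: X0_def interp_pow_rank_one)
  qed
  \<comment> \<open>\<open>A0\<close> is singular with trace 1, so \<open>interp_pow\<close> returns
    it unchanged; the exponent \<open>r\<close> disappears in the limit. The same happens for the
    limit of \<open>G h ** A h ** G h\<close>.\<close>
  have lAr: "((\<lambda>h. mpow (A h) r) \<longlongrightarrow> A0) (at_right 0)"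
  proof -
    have e: "det A0 = 0" "Re (trace A0) = 1"
      using c(3) by (simp_all add: A0 det_2 trace_def sum_2 power2_eq_square)
    have "((\<lambda>h. mpow (A h) r) \<longlongrightarrow> interp_pow A0 r) (at_right 0)"
      using e r by (intro tendsto_mpow lA eventually_mono[OF ev pA]) auto
    then show ?thesis using e by (simp add: interp_pow_rank_one)
  qed
  have lBr: "((\<lambda>h. mpow (G h ** A h ** G h) r) \<longlongrightarrow> diagm (d 1 0)) (at_right 0)"
  proof -
    have e: "det (diagm (d 1 0)) = 0" "Re (trace (diagm (d 1 0))) = 1"
      by (simp_all add: det_2 trace_def sum_2 diagm_def d_def)
    have "((\<lambda>h. mpow (G h ** A h ** G h) r) \<longlongrightarrow> interp_pow (diagm (d 1 0)) r) (at_right 0)"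
      using e r by (intro tendsto_mpow lB eventually_mono[OF ev pB]) auto
    then show ?thesis using e by (simp add: interp_pow_rank_one)
  qed
  have S: "(1 - b) *\<^sub>R A0 + b *\<^sub>R diagm (d 1 0) = S"
    unfolding A0 S_def d_def by (simp add: mat2_simps scaleR_conv_of_real[where 'a = complex])
  have lZ: "(Z \<longlongrightarrow> S) (at_right 0)"
    unfolding Z_def S[symmetric] by (intro tendsto_intros lAr lBr)
  have lY: "(Y \<longlongrightarrow> interp_pow S (1/q)) (at_right 0)"
  proof -
    have t: "Re (trace S) = 1"
      unfolding S_def using c(3) by (simp add: trace_def sum_2) algebra
    have dt: "Re (det S) = b * (1 - b) * s\<^sup>2"
      unfolding S_def by (simp add: det_2 power2_eq_square algebra_simps)
    \<comment> \<open>The discriminant of \<open>S\<close> is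
      \<open>1 - 4 * b * (1 - b) * s^2\<close>; it is positive since
      \<open>4 * b * (1 - b) \<le> 1\<close> and \<open>s^2 < 1\<close>.\<close>
    have "0 \<le> (1 - 2 * b)\<^sup>2" by simp
    then have "4 * (b * (1 - b)) \<le> 1" by (simp add: power2_eq_square algebra_simps)
    then have "4 * (b * (1 - b)) * s\<^sup>2 \<le> 1 * s\<^sup>2"
      by (intro mult_right_mono) auto
    moreover have "s\<^sup>2 < 1" using c zero_less_power[OF c(1), of 2] by linarith
    ultimately have "4 * (b * (1 - b)) * s\<^sup>2 < 1" by linarith
    then show ?thesis unfolding Y_def using t dt q
      by (intro tendsto_mpow lZ eventually_mono[OF ev pZ]) auto
  qed
  have le: "\<forall>\<^sub>F h in at_right 0. Re (trace (X h ** X h)) \<le> Re (trace (X h ** Y h))"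
    using ev
  proof eventually_elim
    case (elim h)
    have "near_le (X h) (Y h)"
      using near[OF pA[OF elim] pG[OF elim]] by (simp add: X_def Y_def Z_def Gb elim)
    then show ?case
      using mpow_posdef[OF pF[OF elim]] mpow_posdef[OF pZ[OF elim]]
      by (intro near_le_trace) (simp_all add: X_def Y_def)
  qed
  have "Re (trace (X0 ** X0)) \<le> Re (trace (X0 ** interp_pow S (1/q)))"
    by (rule tendsto_le[OF trivial_limit_at_right_real _ _ le])
      (intro tendsto_Re_trace tendsto_matrix_mult lX lY)+
  \<comment> \<open>\<open>X0\<close> has \<open>f powr (1/p)\<close> in the corner and zeros
    elsewhere, so the traces see only corner entries and one factor cancels.\<close>
  then have "f powr (1/p) * f powr (1/p) \<le> f powr (1/p) * Re (interp_pow S (1/q) $ 1 $ 1)"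
    using f0 by (simp add: X0_def trace_def mat2_simps d_def scaleR_conv_of_real[where 'a = complex])
  then have "f powr (1/p) \<le> Re (interp_pow S (1/q) $ 1 $ 1)"
    using f0 by simp
  then show ?thesis by (simp add: f_def powr_powr)
qed

text \<open>At \<open>y = 0\<close> both sides equal 1, so the inequality passes to the one-sided
  derivatives. The last summand is \<open>o(y)\<close> because \<open>k > 0\<close>, and contributes
  nothing.\<close>

lemma boundary_slope:
  fixes a e k m :: real
  assumes k: "0 < k"
    and ineq: "\<forall>\<^sub>F y in at_right 0. (1 - e * (y * (1 - y))) powr m \<le>
      (1 - y) powr k * ((1 - y) * (1 - a * y) / (1 - 2 * y)) +
      y powr k * (y * (a * (1 - y) - 1) / (1 - 2 * y))"
  shows "k + a \<le> e * m + 1"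
proof -
  define \<phi> where "\<phi> y = (1 - y) powr k * ((1 - y) * (1 - a * y) / (1 - 2 * y)) -
      (1 - e * (y * (1 - y))) powr m" for y
  have "(\<phi> has_real_derivative (1 - k - a + e * m)) (at 0)"
    unfolding \<phi>_def by (auto intro!: derivative_eq_intros simp: field_simps)
  then have "((\<lambda>y. \<phi> y / y) \<longlongrightarrow> 1 - k - a + e * m) (at_right 0)"
    by (auto simp: has_field_derivative_iff \<phi>_def intro: tendsto_mono[OF at_le])
  moreover have "((\<lambda>y. y powr k * ((a * (1 - y) - 1) / (1 - 2 * y))) \<longlongrightarrow> 0 powr k * ((a * (1 - 0) - 1) / (1 - 2 * 0))) (at_right 0)"
    using k by (intro tendsto_intros) (auto intro: eventually_mono[OF eventually_at_right_less])
  ultimately have lim: "((\<lambda>y. \<phi> y / y + y powr k * ((a * (1 - y) - 1) / (1 - 2 * y)))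
      \<longlongrightarrow> (1 - k - a + e * m) + 0 powr k * ((a * (1 - 0) - 1) / (1 - 2 * 0))) (at_right 0)"
    by (rule tendsto_add)
  have "\<forall>\<^sub>F y in at_right 0. 0 \<le> \<phi> y / y + y powr k * ((a * (1 - y) - 1) / (1 - 2 * y))"
    using ineq eventually_at_right_less[of 0]
  proof eventually_elim
    case (elim y)
    then have "0 \<le> (\<phi> y + y powr k * (y * (a * (1 - y) - 1) / (1 - 2 * y))) / y"
      unfolding \<phi>_def by simp
    also have "\<dots> = \<phi> y / y + y powr k * ((a * (1 - y) - 1) / (1 - 2 * y))"
      using elim by (simp add: add_divide_distrib)
    finally show ?case .
  qed
  from tendsto_lowerbound[OF lim this] show ?thesis using k by simp
qed

lemma near_mean_exponents:
  fixes b p q r :: real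
  assumes b: "0 < b" "b < 1" and p: "0 < p" and q: "0 < q" and r: "0 < r"
    and near: "\<And>A G. posdef A \<Longrightarrow> posdef G \<Longrightarrow> near_le (mpow (mpow G b ** A ** mpow G b) (1/p))
        (mpow ((1 - b) *\<^sub>R mpow A r + b *\<^sub>R mpow (G ** A ** G) r) (1/q))"
  shows "b / q + (1 - b) \<le> 1 / p"
proof -
  \<comment> \<open>Small \<open>y\<close> ensures \<open>s^2 < 1\<close>, so that
    \<open>c > 0\<close>; the bound \<open>y < 1/2\<close> below makes \<open>1 - y\<close> the
    larger eigenvalue.\<close>
  have "((\<lambda>y. y * (1 - y) / (b * (1 - b))) \<longlongrightarrow> 0 * (1 - 0) / (b * (1 - b))) (at_right 0)"
    using b by (intro tendsto_intros) auto
  then have "\<forall>\<^sub>F y in at_right 0. y * (1 - y) / (b * (1 - b)) < 1"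
    by (rule order_tendstoD) simp
  moreover have "\<forall>\<^sub>F y in at_right 0. y < (1/2 :: real)"
    by (rule order_tendstoD[OF tendsto_ident_at]) simp
  ultimately have "\<forall>\<^sub>F y in at_right 0. (1 - 1 / (b * (1 - b)) * (y * (1 - y))) powr ((1 - b) / p) \<le>
      (1 - y) powr (1/q) * ((1 - y) * (1 - 1 / b * y) / (1 - 2 * y)) +
      y powr (1/q) * (y * (1 / b * (1 - y) - 1) / (1 - 2 * y))"
    using eventually_at_right_less[of 0]
  proof eventually_elim
    case (elim y)
    \<comment> \<open>\<open>x = s\<^sup>2\<close> is chosen so that the limit matrix \<open>S\<close> has the eigenvalues \<open>y\<close> and \<open>1 - y\<close>.\<close>
    define x where "x = y * (1 - y) / (b * (1 - b))"
    define c s where "c = sqrt (1 - x)" and "s = sqrt x"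
    have x: "0 < x" "x < 1" using elim b by (simp_all add: x_def)
    have cs: "c\<^sup>2 = 1 - x" "s\<^sup>2 = x" "0 < c" "0 < s"
      using x by (simp_all add: c_def s_def)
    have bx: "b * (1 - b) * x = y * (1 - y)" using b by (simp add: x_def)
    define S :: cmat2 where "S = (\<chi> i j. of_real (if i = 1 then (if j = 1 then (1 - b) * c\<^sup>2 + b else (1 - b) * c * s)
      else (if j = 1 then (1 - b) * c * s else (1 - b) * s\<^sup>2)))"
    have le: "(1 - x) powr ((1 - b) / p) \<le> Re (interp_pow S (1/q) $ 1 $ 1)"
      using near_mean_limit[OF b p q r cs(3,4) _ near] cs unfolding S_def by simp
    have tr: "Re (trace S) = 1"
      unfolding S_def by (simp add: trace_def sum_2 cs algebra_simps)
    have "Re (det S) = b * (1 - b) * s\<^sup>2"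
      unfolding S_def by (simp add: det_2 power2_eq_square algebra_simps)
    then have dt: "Re (det S) = y * (1 - y)" using bx cs by simp
    have "eig_gap S = sqrt ((1 - 2 * y)\<^sup>2)"
      unfolding eig_gap_def tr dt by (simp add: power2_eq_square algebra_simps)
    then have g: "eig_gap S = 1 - 2 * y" using elim by simp
    have ev: "eig_max S = 1 - y" "eig_min S = y"
      unfolding eig_max_def eig_min_def g tr by simp_all
    have S11: "S $ 1 $ 1 = of_real (1 - y * (1 - y) / b)"
    proof -
      have "(1 - b) * x = y * (1 - y) / b" using bx b by (simp add: field_simps)
      then have "(1 - b) * c\<^sup>2 + b = 1 - y * (1 - y) / b"
        by (simp add: cs algebra_simps)
      then show ?thesis by (simp add: S_def)
    qed
    have "Re (interp_pow S (1/q) $ 1 $ 1) =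
      ((1 - y) powr (1/q) - y powr (1/q)) / (1 - 2 * y) * (1 - y * (1 - y) / b) +
      ((1 - y) * y powr (1/q) - y * (1 - y) powr (1/q)) / (1 - 2 * y)"
      by (simp add: interp_pow_def ev g S11 mat_def)
    \<comment> \<open>Terms are grouped by the powers of \<open>1 - y\<close> and \<open>y\<close>,
      using \<open>1 - y * (1 - y) / b - y = (1 - y) * (1 - y / b)\<close>.\<close>
    also have "\<dots> = (1 - y) powr (1/q) * ((1 - y) * (1 - 1 / b * y) / (1 - 2 * y)) +
      y powr (1/q) * (y * (1 / b * (1 - y) - 1) / (1 - 2 * y))"
      using elim b by (simp add: divide_simps) (simp add: algebra_simps)
    finally show ?case using le by (simp add: x_def)
  qed
  \<comment> \<open>The slope lemma is applied with \<open>k = 1/q\<close>, \<open>a = 1/b\<close>,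
    \<open>e = 1 / (b * (1 - b))\<close> and \<open>m = (1 - b) / p\<close>; multiplying by
    \<open>b\<close> then gives the claim.\<close>
  from boundary_slope[OF _ this] q have "1/q + 1/b \<le> 1 / (b * (1 - b)) * ((1 - b) / p) + 1" by simp
  also have "1 / (b * (1 - b)) * ((1 - b) / p) = 1 / (b * p)" using b by simp
  finally have "b * (1/q + 1/b) \<le> b * (1 / (b * p) + 1)" using b by simp
  then show ?thesis using b p by (simp add: distrib_left)
qed

section \<open>Both means in terms of a freely chosen pair \<open>A\<close>,
  \<open>G\<close>\<close>

lemma SG_sandwich:
  assumes A: "posdef A" and G: "posdef G" and "0 < p"
  shows "SG \<alpha> p (mpow A (1/p)) (mpow (G ** A ** G) (1/p)) = mpow (mpow G \<alpha> ** A ** mpow G \<alpha>) (1/p)"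
  using assms by (simp add: SG_def mpow_mpow mpow_1 posdef_sandwich Fa_sandwich)

text \<open>With \<open>B = G A G\<close> one has \<open>A = G^(-1) B G^(-1)\<close>, so exchanging
  the arguments replaces \<open>G\<close> by its inverse. The two outer factors \<open>G\<close> of
  \<open>B\<close> turn \<open>G^(-\<alpha>)\<close> into \<open>G^(1 - \<alpha>)\<close>.\<close>

lemma SG_sandwich_swap:
  assumes A: "posdef A" and G: "posdef G" and "0 < p"
  shows "SG \<alpha> p (mpow (G ** A ** G) (1/p)) (mpow A (1/p)) = mpow (mpow G (1 - \<alpha>) ** A ** mpow G (1 - \<alpha>)) (1/p)"
proof -
  let ?B = "G ** A ** G" and ?H = "mpow G (-1)"
  have H: "posdef ?H" and B: "posdef ?B"
    using A G by (auto intro: mpow_posdef posdef_sandwich)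
  have GH: "?H ** G = mat 1" "G ** ?H = mat 1"
    using mpow_minus_mult[OF G, of 1] by (simp_all add: mpow_1 G)
  have "?H ** ?B ** ?H = (?H ** G) ** A ** (G ** ?H)" by (simp only: matrix_mul_assoc)
  then have "?H ** ?B ** ?H = A" by (simp add: GH)
  then have "SG \<alpha> p (mpow ?B (1/p)) (mpow A (1/p)) = mpow (mpow ?H \<alpha> ** ?B ** mpow ?H \<alpha>) (1/p)"
    using SG_sandwich[OF B H \<open>0 < p\<close>, of \<alpha>] by simp
  moreover have "mpow ?H \<alpha> ** ?B ** mpow ?H \<alpha> = mpow G (1 - \<alpha>) ** A ** mpow G (1 - \<alpha>)"
  proof -
    have "mpow ?H \<alpha> ** G = mpow G (1 - \<alpha>)" "G ** mpow ?H \<alpha> = mpow G (1 - \<alpha>)"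
      using mpow_add[OF G, of "-\<alpha>" 1] mpow_add[OF G, of 1 "-\<alpha>"] by (simp_all add: mpow_mpow mpow_1 G)
    then show ?thesis by (metis matrix_mul_assoc)
  qed
  ultimately show ?thesis by simp
qed

lemma Amean_mpow:
  assumes "posdef A" "posdef B"
  shows "Amean \<alpha> q (mpow A (1/p)) (mpow B (1/p)) =
    mpow ((1 - \<alpha>) *\<^sub>R mpow A (q / p) + \<alpha> *\<^sub>R mpow B (q / p)) (1/q)"
  using assms by (simp add: Amean_def mpow_mpow)

theorem theorem4p24:
  fixes \<alpha> p q :: real
  assumes "0 < \<alpha>" and "\<alpha> < 1" and "0 < p" and "0 < q"
    and "\<forall>A B. posdef A \<and> posdef B \<longrightarrow> near_le (SG \<alpha> p A B) (Amean \<alpha> q A B)"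
  shows "q / p \<ge> 1 + max (\<alpha> * (q - 1)) ((1 - \<alpha>) * (q - 1)) \<and>
    (q \<ge> 1 \<longrightarrow> q / p \<ge> 1 + max \<alpha> (1 - \<alpha>) * (q - 1) \<and> 1 + max \<alpha> (1 - \<alpha>) * (q - 1) \<ge> 1) \<and>
    (q \<le> 1 \<longrightarrow> q / p \<ge> 1 - min \<alpha> (1 - \<alpha>) * (1 - q) \<and> 1 - min \<alpha> (1 - \<alpha>) * (1 - q) \<ge> max \<alpha> (1 - \<alpha>))"
proof -
  have near: "near_le (SG \<alpha> p A B) (Amean \<alpha> q A B)" if "posdef A" "posdef B" for A B
    using assms(5) that by blast
  have e1: "\<alpha> / q + (1 - \<alpha>) \<le> 1 / p"
  proof (rule near_mean_exponents[where r = "q / p"])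
    fix A G assume "posdef A" "posdef G"
    then show "near_le (mpow (mpow G \<alpha> ** A ** mpow G \<alpha>) (1/p))
        (mpow ((1 - \<alpha>) *\<^sub>R mpow A (q / p) + \<alpha> *\<^sub>R mpow (G ** A ** G) (q / p)) (1/q))"
      using near[of "mpow A (1/p)" "mpow (G ** A ** G) (1/p)"] assms(3)
      by (simp add: SG_sandwich Amean_mpow mpow_posdef posdef_sandwich)
  qed (use assms in auto)
  \<comment> \<open>The hypothesis is used with its two arguments exchanged, which gives the same
    situation with weight \<open>1 - \<alpha>\<close>.\<close>
  have e2: "(1 - \<alpha>) / q + (1 - (1 - \<alpha>)) \<le> 1 / p"
  proof (rule near_mean_exponents[where r = "q / p"])
    fix A G assume "posdef A" "posdef G"
    then show "near_le (mpow (mpow G (1 - \<alpha>) ** A ** mpow G (1 - \<alpha>)) (1/p))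
        (mpow ((1 - (1 - \<alpha>)) *\<^sub>R mpow A (q / p) + (1 - \<alpha>) *\<^sub>R mpow (G ** A ** G) (q / p)) (1/q))"
      using near[of "mpow (G ** A ** G) (1/p)" "mpow A (1/p)"] assms(3)
      by (simp add: SG_sandwich_swap Amean_mpow mpow_posdef posdef_sandwich add.commute)
  qed (use assms in auto)
  have "q * (\<alpha> / q + (1 - \<alpha>)) \<le> q * (1 / p)" "q * ((1 - \<alpha>) / q + (1 - (1 - \<alpha>))) \<le> q * (1 / p)"
    using e1 e2 assms(4) by (intro mult_left_mono; simp)+
  moreover have "q * (\<alpha> / q + (1 - \<alpha>)) = \<alpha> + q * (1 - \<alpha>)"
    "q * ((1 - \<alpha>) / q + (1 - (1 - \<alpha>))) = (1 - \<alpha>) + q * \<alpha>"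
    using assms(4) by (simp_all add: distrib_left)
  ultimately have m: "1 + (1 - \<alpha>) * (q - 1) \<le> q / p" "1 + \<alpha> * (q - 1) \<le> q / p"
    by (simp_all add: algebra_simps)
  \<comment> \<open>The maximum is \<open>1 - min \<alpha> (1 - \<alpha>)\<close>, and
    \<open>1 - q \<le> 1\<close>.\<close>
  have "max \<alpha> (1 - \<alpha>) \<le> 1 - min \<alpha> (1 - \<alpha>) * (1 - q)"
  proof -
    have "min \<alpha> (1 - \<alpha>) * (1 - q) \<le> min \<alpha> (1 - \<alpha>) * 1"
      using assms by (intro mult_left_mono) auto
    then show ?thesis by (auto simp: max_def min_def)
  qed
  moreover have "0 \<le> max \<alpha> (1 - \<alpha>) * (q - 1)" if "1 \<le> q"
    using assms that by simp
  ultimately show ?thesis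
    using m by (auto simp: max_def min_def algebra_simps)
qed

end
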